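(* For every integer $n \geq 6$, the simplicial $3$-sphere $\Delta^3_n$ of Jockusch's family is not polytopal; that is, there is no convex polytope (equivalently, no simplicial $4$-polytope) whose boundary complex is isomorphic, as an abstract simplicial complex, to $\Delta^3_n$.
   Context: A simplicial sphere is called polytopal (realizable) if it is isomorphic, as an abstract simplicial complex, to the boundary complex of a convex polytope. Jockusch's family $\Delta^3_n$ ($n\ge 4$) consists of pure $3$-dimensional simplicial complexes, each homeomorphic to the $3$-sphere, on the vertex set $V_n=\{1,\dots,n,-1,\dots,-n\}$, with $2n$ vertices and $2n(n-2)$ facets. Here $-n$ is a vertex label distinct from $n$, and for a set $F$ of labels $-F=\{-v : v\in F\}$; for a complex $B$, $-B$ is the complex whose facets are the sets $-F$ with $F$ a facet of $B$. All complexes are described by their facets. For $n\ge 4$, let $B^{3,1}_n$ be the pure $3$-dimensional complex (a $3$-ball) whose $2n-3$ facets are: (i) all sets $e\cup\{n-1,n\}$, where $e$ ranges over the $2n-5$ pairs of consecutive entries of the sequence $(-1,-2,\dots,-(n-2),1,2,\dots,n-2)$, that is, $e=\{-i,-(i+1)\}$ or $e=\{i,i+1\}$ for $1\le i\le n-3$, or $e=\{-(n-2),1\}$; (ii) $\{1,-(n-2),-(n-1),n\}$; (iii) $\{1,-(n-2),-(n-1),-n\}$. The complexes $\Delta^3_n$ are defined inductively. - $\Delta^3_4$ is the boundary complex of the $4$-dimensional cross-polytope on $V_4$: its $16$ facets are the sets $\{\varepsilon_1 1,\varepsilon_2 2,\varepsilon_3 3,\varepsilon_4 4\}$ with $\varepsilon_i\in\{+1,-1\}$.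 - For $n\ge 4$, $B^{3,1}_n$ and $-B^{3,1}_n$ are subcomplexes of $\Delta^3_n$ with no facet in common. The complex $\Delta^3_{n+1}$ is obtained from $\Delta^3_n$ by deleting all facets of $B^{3,1}_n$ and of $-B^{3,1}_n$, and adding as new facets all sets $T\cup\{n+1\}$ and $-T\cup\{-(n+1)\}$, where $T$ ranges over the boundary triangles of $B^{3,1}_n$ (the $3$-element sets contained in exactly one facet of $B^{3,1}_n$). *)

theory Defs
  imports "HOL-Analysis.Polytope"
begin

text \<open>
  An abstract simplicial complex is the set of all its faces, the empty face included.
  The complexes of the family are given by their sets of facets.  The vertex labels are
  nonzero integers, so that the label written \<open>-v\<close> is the integer \<open>- v\<close>.
\<close>

definition complex_of_facets :: "'v set set \<Rightarrow> 'v set set" where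
  "complex_of_facets \<F> = {S. \<exists>F\<in>\<F>. S \<subseteq> F}"

definition isomorphic_complexes :: "'v set set \<Rightarrow> 'w set set \<Rightarrow> bool" where
  "isomorphic_complexes K L \<longleftrightarrow>
     (\<exists>f. bij_betw f (\<Union>K) (\<Union>L) \<and> (\<forall>S. S \<subseteq> \<Union>K \<longrightarrow> (S \<in> K \<longleftrightarrow> f ` S \<in> L)))"

text \<open>
  The boundary complex of a polytope is recorded through the vertex sets of its proper faces
  (the empty face included).  For a polytope that is not simplicial this family is not closed
  under subsets, and then it is isomorphic to no simplicial complex.
\<close>

definition boundary_complex :: "'a::euclidean_space set \<Rightarrow> 'a set set" where
  "boundary_complex P = {{v. v extreme_point_of F} | F. F face_of P \<and> F \<noteq> P}"

text \<open>
  The type argument is the ambient Euclidean space; the polytope need not be full-dimensional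
  in it.
\<close>

definition polytopal :: "'a::euclidean_space itself \<Rightarrow> 'v set set \<Rightarrow> bool" where
  "polytopal _ K \<longleftrightarrow> (\<exists>P :: 'a set. polytope P \<and> isomorphic_complexes K (boundary_complex P))"

definition neg_facets :: "int set set \<Rightarrow> int set set" where
  "neg_facets \<F> = (\<lambda>F. uminus ` F) ` \<F>"

definition boundary_triangles :: "'v set set \<Rightarrow> 'v set set" where
  "boundary_triangles \<F> = {T. card T = 3 \<and> (\<exists>!F. F \<in> \<F> \<and> T \<subseteq> F)}"

text \<open>The pairs of consecutive entries of \<open>(-1, -2, \<dots>, -(n - 2), 1, 2, \<dots>, n - 2)\<close>.\<close>

definition consecutive_pairs :: "int \<Rightarrow> int set set" where
  "consecutive_pairs n =
     {{- i, - (i + 1)} | i. 1 \<le> i \<and> i \<le> n - 3} \<union>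
     {{i, i + 1} | i. 1 \<le> i \<and> i \<le> n - 3} \<union>
     {{- (n - 2), 1}}"

definition B31_facets :: "int \<Rightarrow> int set set" where
  "B31_facets n =
     {e \<union> {n - 1, n} | e. e \<in> consecutive_pairs n} \<union>
     {{1, - (n - 2), - (n - 1), n}, {1, - (n - 2), - (n - 1), - n}}"

definition cross_polytope_facets :: "int set set" where
  "cross_polytope_facets =
     {{\<epsilon>1 * 1, \<epsilon>2 * 2, \<epsilon>3 * 3, \<epsilon>4 * 4} | \<epsilon>1 \<epsilon>2 \<epsilon>3 \<epsilon>4.
        \<epsilon>1 \<in> {1, -1} \<and> \<epsilon>2 \<in> {1, -1} \<and> \<epsilon>3 \<in> {1, -1} \<and> \<epsilon>4 \<in> {1, -1}}"

text \<open>The family is meant for \<open>n \<ge> 4\<close>; the values for \<open>n < 4\<close> are irrelevant.\<close>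

primrec Delta3_facets :: "nat \<Rightarrow> int set set" where
  "Delta3_facets 0 = cross_polytope_facets"
| "Delta3_facets (Suc n) =
     (if n < 4 then cross_polytope_facets
      else (Delta3_facets n - (B31_facets (int n) \<union> neg_facets (B31_facets (int n)))) \<union>
           {T \<union> {int n + 1} | T. T \<in> boundary_triangles (B31_facets (int n))} \<union>
           {uminus ` T \<union> {- (int n + 1)} | T. T \<in> boundary_triangles (B31_facets (int n))})"

lemma Delta3_facets_4: "Delta3_facets 4 = cross_polytope_facets"
  by (simp add: eval_nat_numeral)

definition Delta3 :: "nat \<Rightarrow> int set set" where
  "Delta3 n = complex_of_facets (Delta3_facets n)"

end

theory Submission
  imports Defs "HOL-Analysis.Homotopy" "HOL-Analysis.Determinants"
begin

text \<open>
  In a realization as a polytope \<open>P\<close> every facet has four affinely independent vertices, so \<open>P\<close> is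
  four-dimensional, and after homogenization any five vertices \<open>a, \<dots>, e\<close> have a determinant
  \<open>[a b c d e]\<close>.  Two facts govern the signs of these brackets.  If \<open>{a, b, c, d}\<close> is a facet, all
  other vertices lie strictly on one side of its hyperplane, so \<open>[a b c d x]\<close> has the same nonzero
  sign for all of them (\<open>polytopal_brackets\<close>).  And all brackets satisfy the three-term
  Grassmann-Pluecker relations
  \<open>[p q r a c] [p q r b d] = [p q r a b] [p q r c d] + [p q r a d] [p q r b c]\<close>
  (\<open>three_term_relation\<close>), so that two positive products on the right force the sign of the product
  on the left.  It turns out that the signs prescribed by the facets contradict these relations.

  The contradiction involves few facets.  The step from \<open>n\<close> to \<open>n + 1\<close> removes only facets that
  contain \<open>n\<close> or \<open>-n\<close>, so there are fifteen facets on the labels \<open>-6, \<dots>, 6\<close> which, with their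
  antipodes, belong to the complex for every \<open>n \<ge> 6\<close> (\<open>stable_facets_subset\<close>,
  \<open>uminus_mem_Delta3\<close>).  Two facets \<open>{a, b, c, d}\<close> and \<open>{a, b, c, e}\<close> that share a triangle both
  determine the sign of \<open>[a b c d e]\<close>, so the side of one determines the side of the other.  The
  fifteen facets are connected through shared triangles, hence one choice of sign fixes the
  sides of all of them (\<open>coherent_or_opposite\<close>); changing the sign of all brackets if necessary, this
  choice is the one recorded in \<open>oriented_stable_facets\<close>.

  The same applies to the antipodal facets, with a second choice of sign.  No triangle is shared by
  one of the fifteen facets and an antipode of one, so this argument does not compare the two
  choices; instead both possibilities are refuted.  In each of them the facets determine about two
  dozen brackets, a few three-term relations then force the signs of further brackets one after the
  other, and in the last relation the right-hand side is positive and the left-hand side negative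
  (\<open>not_coherent_opposite\<close>, \<open>not_coherent_same\<close>).
\<close>

section \<open>Brackets of five vectors\<close>

text \<open>
  The rows of the determinant need an index type with exactly five elements whose cases can be
  named; the vectors themselves live in the space indexed by the same type.
\<close>

definition bracket ::
  "real^Enum.finite_5 \<Rightarrow> real^Enum.finite_5 \<Rightarrow> real^Enum.finite_5 \<Rightarrow> real^Enum.finite_5 \<Rightarrow> real^Enum.finite_5 \<Rightarrow> real"
  where "bracket a b c d e =
    det (\<chi> i. case i of Enum.finite_5.a\<^sub>1 \<Rightarrow> a | Enum.finite_5.a\<^sub>2 \<Rightarrow> b | Enum.finite_5.a\<^sub>3 \<Rightarrow> c
                 | Enum.finite_5.a\<^sub>4 \<Rightarrow> d | Enum.finite_5.a\<^sub>5 \<Rightarrow> e)"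

lemma det_transpose_rows:
  fixes A :: "real^'n^'n"
  assumes "j \<noteq> k"
  shows "det (\<chi> i. A $ Transposition.transpose j k i) = - det A"
  using det_permute_rows[of "Transposition.transpose j k" A] assms
  by (simp add: permutes_swap_id sign_swap_id)

lemma bracket_swap:
  "bracket b a c d e = - bracket a b c d e"
  "bracket a c b d e = - bracket a b c d e"
  "bracket a b d c e = - bracket a b c d e"
  "bracket a b c e d = - bracket a b c d e"
  unfolding bracket_def
  by (subst det_transpose_rows[symmetric, of Enum.finite_5.a\<^sub>1 Enum.finite_5.a\<^sub>2]
            det_transpose_rows[symmetric, of Enum.finite_5.a\<^sub>2 Enum.finite_5.a\<^sub>3]
            det_transpose_rows[symmetric, of Enum.finite_5.a\<^sub>3 Enum.finite_5.a\<^sub>4]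
            det_transpose_rows[symmetric, of Enum.finite_5.a\<^sub>4 Enum.finite_5.a\<^sub>5], simp,
      rule arg_cong[where f = det], auto simp: vec_eq_iff Transposition.transpose_def split: Enum.finite_5.split)+

lemma linear_bracket: "linear (bracket a b c d)"
proof -
  \<comment> \<open>The value of \<open>R\<close> at the last index is arbitrary, because that row is overwritten by the argument.\<close>
  define R where "R = (\<lambda>i. case i of Enum.finite_5.a\<^sub>1 \<Rightarrow> a | Enum.finite_5.a\<^sub>2 \<Rightarrow> b | Enum.finite_5.a\<^sub>3 \<Rightarrow> c | Enum.finite_5.a\<^sub>4 \<Rightarrow> d
    | Enum.finite_5.a\<^sub>5 \<Rightarrow> d)"
  have eq: "bracket a b c d x = det (\<chi> i. if i = Enum.finite_5.a\<^sub>5 then x else R i)" for x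
    unfolding bracket_def R_def
    by (rule arg_cong[where f = det]) (auto simp: vec_eq_iff split: Enum.finite_5.split)
  show ?thesis
    by (rule linearI) (simp_all add: eq det_row_add det_row_mul flip: scalar_mult_eq_scaleR)
qed

lemma bracket_eq_0_span:
  assumes "x \<in> span {a, b, c, d}"
  shows "bracket a b c d x = 0"
proof (rule linear_eq_0_on_span[OF linear_bracket _ assms])
  fix y assume "y \<in> {a, b, c, d}"
  moreover have "bracket a b c d d = 0" "bracket a b c c d = 0" "bracket a b b d c = 0" "bracket a a b d c = 0"
    using bracket_swap(4)[of a b c d d] bracket_swap(3)[of a b c c d] bracket_swap(2)[of a b b d c]
      bracket_swap(1)[of a a b d c] by simp_all
  moreover have "bracket a b c d c = - bracket a b c c d" "bracket a b c d b = bracket a b b d c"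
    "bracket a b c d a = - bracket a a b d c"
    by (metis bracket_swap minus_minus)+
  ultimately show "bracket a b c d y = 0" by auto
qed

lemma bracket_nonzero_iff: "bracket a b c d e \<noteq> 0 \<longleftrightarrow> span {a, b, c, d, e} = UNIV"
proof -
  have UN: "(UNIV :: Enum.finite_5 set) = {Enum.finite_5.a\<^sub>1, Enum.finite_5.a\<^sub>2, Enum.finite_5.a\<^sub>3, Enum.finite_5.a\<^sub>4, Enum.finite_5.a\<^sub>5}"
    using Enum.UNIV_finite_5 by simp
  define A :: "real^Enum.finite_5^Enum.finite_5" where "A =
    (\<chi> i. case i of Enum.finite_5.a\<^sub>1 \<Rightarrow> a | Enum.finite_5.a\<^sub>2 \<Rightarrow> b | Enum.finite_5.a\<^sub>3 \<Rightarrow> c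
            | Enum.finite_5.a\<^sub>4 \<Rightarrow> d | Enum.finite_5.a\<^sub>5 \<Rightarrow> e)"
  have "rows A = (\<lambda>i. A $ i) ` UNIV"
    by (auto simp: rows_def row_def)
  also have "\<dots> = {a, b, c, d, e}" unfolding UN by (simp add: A_def)
  finally have "rows A = {a, b, c, d, e}" .
  then show ?thesis
    unfolding bracket_def A_def[symmetric]
    using invertible_det_nz[of A] matrix_left_invertible_span_rows[of A] by (metis invertible_left_inverse)
qed

text \<open>
  With three arguments fixed, the bracket is an alternating form on the quotient by their span.
  Where it does not vanish this quotient is a plane and the form is a multiple of the 2-by-2
  determinant, so the relation is the quadratic identity between the six 2-by-2 minors of a
  2-by-4 matrix.
\<close>

lemma three_term_relation:
  "bracket p q r a c * bracket p q r b d =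
   bracket p q r a b * bracket p q r c d + bracket p q r a d * bracket p q r b c"
proof -
  let ?B = "bracket p q r"
  have swap: "?B y x = - ?B x y" for x y by (rule bracket_swap)
  have red: "?B x (s + t) = ?B x t" if "s \<in> span {p, q, r}" for x s t
  proof -
    have "s \<in> span {p, q, r, x}" using that span_mono[of "{p, q, r}" "{p, q, r, x}"] by auto
    then show ?thesis by (simp add: linear_add[OF linear_bracket] bracket_eq_0_span)
  qed
  \<comment> \<open>Expand \<open>c\<close> and \<open>d\<close> in the basis given by \<open>a\<close> and \<open>b\<close> of the plane.\<close>
  have main: "?B a c * ?B b d = ?B a b * ?B c d + ?B a d * ?B b c" if nz: "?B a b \<noteq> 0" for a b c d
  proof -
    have expand: "\<exists>s \<in> span {p, q, r}. \<exists>u v. x = s + (u *\<^sub>R a + v *\<^sub>R b)" for x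
    proof -
      have "x \<in> span (insert b (insert a {p, q, r}))"
        using nz by (simp add: bracket_nonzero_iff insert_commute)
      then obtain v where "x - v *\<^sub>R b \<in> span (insert a {p, q, r})" by (auto simp: span_insert[of b])
      then obtain u where "x - v *\<^sub>R b - u *\<^sub>R a \<in> span {p, q, r}" by (auto simp: span_insert[of a])
      moreover have "x = (x - v *\<^sub>R b - u *\<^sub>R a) + (u *\<^sub>R a + v *\<^sub>R b)" by simp
      ultimately show ?thesis by blast
    qed
    obtain s u v where s: "s \<in> span {p, q, r}" and c: "c = s + (u *\<^sub>R a + v *\<^sub>R b)" using expand by blast
    obtain t w z where t: "t \<in> span {p, q, r}" and d: "d = t + (w *\<^sub>R a + z *\<^sub>R b)" using expand by blast
    have self: "?B x x = 0" for x using swap[of x x] by simp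
    have lin: "?B x (u *\<^sub>R a + v *\<^sub>R b) = u * ?B x a + v * ?B x b" for x u v
      by (simp add: linear_add[OF linear_bracket] linear_scale[OF linear_bracket])
    have ac: "?B a c = v * ?B a b" and bc: "?B b c = - u * ?B a b"
      unfolding c red[OF s] lin using self swap[of a b] by simp_all
    have ad: "?B a d = z * ?B a b" and bd: "?B b d = - w * ?B a b"
      unfolding d red[OF t] lin using self swap[of a b] by simp_all
    have "?B c d = w * ?B c a + z * ?B c b" unfolding d red[OF t] lin by simp
    also have "\<dots> = (u * z - v * w) * ?B a b"
      using ac bc swap[of c a] swap[of c b] by (simp add: algebra_simps)
    finally have cd: "?B c d = (u * z - v * w) * ?B a b" .
    show ?thesis unfolding ac bd ad bc cd by (simp add: algebra_simps)
  qed
  consider "?B a b \<noteq> 0" | "?B a c \<noteq> 0" | "?B a d \<noteq> 0" | "?B a b = 0" "?B a c = 0" "?B a d = 0" by blast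
  then show ?thesis
  proof cases
    case 1 then show ?thesis by (rule main)
  next
    case 2 then show ?thesis using main[of a c b d] swap[of b c] by simp
  next
    case 3 then show ?thesis using main[of a d b c] swap[of d b] swap[of d c] by (simp add: algebra_simps)
  next
    case 4 then show ?thesis by simp
  qed
qed

section \<open>Brackets of a polytopal realization\<close>

text \<open>
  Appending the coordinate \<open>1\<close> turns affine combinations into linear ones, so that affine
  statements about the vertices of a polytope become statements about vectors and their brackets.
\<close>

lemma span_homogenize:
  assumes "x \<in> affine hull S"
  shows "(x, 1::real) \<in> span ((\<lambda>v. (v, 1)) ` S)"
proof -
  obtain T u where T: "finite T" "T \<subseteq> S" "sum u T = 1" "(\<Sum>v\<in>T. u v *\<^sub>R v) = x"
    using assms unfolding affine_hull_explicit by blast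
  have "(x, 1::real) = (\<Sum>v\<in>T. u v *\<^sub>R (v, 1))"
    using T by (simp add: sum_prod prod_eq_iff fst_sum snd_sum)
  also have "\<dots> \<in> span ((\<lambda>v. (v, 1)) ` S)"
    using T by (intro span_sum span_scale span_base) auto
  finally show ?thesis .
qed

lemma independent_homogenize:
  assumes "\<not> affine_dependent S" "finite S"
  shows "independent ((\<lambda>v. (v, 1::real)) ` S)"
proof -
  have "\<forall>v\<in>S. c (v, 1) = 0" if "(\<Sum>z\<in>(\<lambda>v. (v, 1::real)) ` S. c z *\<^sub>R z) = 0" for c
  proof -
    have "(\<Sum>v\<in>S. c (v, 1) *\<^sub>R (v, 1::real)) = 0"
      using that by (subst (asm) sum.reindex) (auto simp: inj_on_def)
    then have "(\<Sum>v\<in>S. c (v, 1) *\<^sub>R v) = 0" "(\<Sum>v\<in>S. c (v, 1)) = 0"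
      by (auto simp: prod_eq_iff fst_sum snd_sum)
    then show ?thesis
      using assms affine_dependent_explicit_finite[OF assms(2)] by meson
  qed
  then show ?thesis
    using dependent_finite[of "(\<lambda>v. (v, 1::real)) ` S"] assms(2) by auto
qed

text \<open>
  A face of a polytope is the convex hull of its extreme points, so the vertex set of a face, which
  is all that the boundary complex records, determines the face.
\<close>

lemma isomorphism_face:
  fixes P :: "'a::euclidean_space set"
  assumes "polytope P" "S \<subseteq> \<Union>K" "S \<in> K"
    and "\<forall>S. S \<subseteq> \<Union>K \<longrightarrow> (S \<in> K \<longleftrightarrow> f ` S \<in> boundary_complex P)"
  shows "convex hull (f ` S) face_of P" "convex hull (f ` S) \<noteq> P"
    "{v. v extreme_point_of convex hull (f ` S)} = f ` S"
proof -
  obtain G where G: "f ` S = {v. v extreme_point_of G}" "G face_of P" "G \<noteq> P"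
    using assms unfolding boundary_complex_def by blast
  have "polytope G" using G(2) assms(1) face_of_polytope_polytope by blast
  then have "G = convex hull (f ` S)"
    unfolding G(1) using Krein_Milman_Minkowski polytope_imp_compact polytope_imp_convex by blast
  then show "convex hull (f ` S) face_of P" "convex hull (f ` S) \<noteq> P"
    "{v. v extreme_point_of convex hull (f ` S)} = f ` S" using G by auto
qed

text \<open>
  A face is cut out of the polytope by its own affine hull.  Hence a vertex that lay in the affine
  hull of the others would lie in the face spanned by them, although it is not one of their convex
  combinations.
\<close>

lemma simplex_affine_independent:
  fixes P :: "'a::euclidean_space set"
  assumes "convex P" and face: "\<And>T. T \<subseteq> S \<Longrightarrow> convex hull T face_of P"
    and ext: "\<And>v. v \<in> S \<Longrightarrow> v extreme_point_of P"
  shows "\<not> affine_dependent S"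
proof
  assume "affine_dependent S"
  then obtain w where w: "w \<in> S" "w \<in> affine hull (S - {w})" unfolding affine_dependent_def by blast
  let ?T = "S - {w}"
  have faceT: "convex hull ?T face_of P" by (rule face) auto
  have "convex hull ?T = affine hull (convex hull ?T) \<inter> P"
    by (rule face_of_imp_eq_affine_Int[OF assms(1) faceT])
  moreover have "w \<in> P" using ext[OF w(1)] by (simp add: extreme_point_of_def)
  ultimately have "w \<in> convex hull ?T" using w(2) by (metis IntI affine_hull_convex_hull)
  moreover have "convex hull ?T \<subseteq> P"
    by (rule face_of_imp_subset[OF faceT])
  ultimately have "w extreme_point_of convex hull ?T"
    using ext[OF w(1)] unfolding extreme_point_of_def by blast
  then have "w \<in> ?T" using extreme_point_of_convex_hull by blast
  then show False by simp
qed

text \<open>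
  Facets of the complex correspond to facets of the polytope.  Since the former have four vertices
  and are simplices, the polytope has dimension four and its homogenized vertices span a space of
  dimension five, which is identified with the space on which the bracket is defined.  For the
  vertices \<open>a, b, c, d\<close> of a facet, the bracket as a function of its last argument and the
  supporting functional of the facet both vanish on the hyperplane spanned by the facet.  So they
  are proportional, and the bracket inherits from the functional that it has one strict sign on all
  the other vertices.
\<close>

lemma polytopal_brackets:
  fixes \<F> :: "'v set set"
  assumes "polytopal TYPE('a::euclidean_space) (complex_of_facets \<F>)"
    and four: "\<forall>F \<in> \<F>. card F = 4"
    and F0: "F0 \<in> \<F>" "v0 \<in> \<Union>\<F> - F0"
  shows "\<exists>u :: 'v \<Rightarrow> real^Enum.finite_5. \<forall>a b c d x y. {a, b, c, d} \<in> \<F> \<longrightarrow>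
    x \<in> \<Union>\<F> - {a, b, c, d} \<longrightarrow> y \<in> \<Union>\<F> - {a, b, c, d} \<longrightarrow>
    0 < bracket (u a) (u b) (u c) (u d) (u x) * bracket (u a) (u b) (u c) (u d) (u y)"
proof -
  note card = bspec[OF four]
  define K where "K = complex_of_facets \<F>"
  define V where "V = \<Union>\<F>"
  have VK: "\<Union>K = V" by (auto simp: K_def V_def complex_of_facets_def)
  obtain P :: "'a set" and f where P: "polytope P" and bij: "bij_betw f V (\<Union>(boundary_complex P))"
    and iso: "\<forall>S. S \<subseteq> \<Union>K \<longrightarrow> (S \<in> K \<longleftrightarrow> f ` S \<in> boundary_complex P)"
    using assms(1) unfolding polytopal_def isomorphic_complexes_def K_def[symmetric] VK by blast
  have cP: "convex P" and pP: "polyhedron P" using P by (auto simp: polytope_imp_convex polytope_imp_polyhedron)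
  have injV: "inj_on f V" using bij by (rule bij_betw_imp_inj_on)
  note face = isomorphism_face[OF P _ _ iso]
  have subK: "T \<in> K" if "F \<in> \<F>" "T \<subseteq> F" for T F using that by (auto simp: K_def complex_of_facets_def)
  have KV: "S \<subseteq> \<Union>K" if "S \<in> K" for S using that by blast
  have fin: "finite F" if "F \<in> \<F>" for F using card[OF that] by (simp add: card_ge_0_finite)
  have ext: "f v extreme_point_of P" if "v \<in> V" for v
  proof -
    have "{v} \<in> K" using that subK by (auto simp: V_def)
    from face(1)[OF KV[OF this] this] show ?thesis by (simp add: face_of_singleton)
  qed
  then have fP: "f v \<in> P" if "v \<in> V" for v using that by (auto simp: extreme_point_of_def)
  define G where "G F = convex hull (f ` F)" for F
  have facet: "G F facet_of P" if F: "F \<in> \<F>" for F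
  proof -
    have FK: "F \<in> K" using subK[OF F] by simp
    note faceF = face[OF KV[OF FK] FK, folded G_def]
    have "F \<noteq> {}" using card[OF F] by auto
    then have "G F \<noteq> {}" by (simp add: G_def)
    then obtain H where H: "H facet_of P" "G F \<subseteq> H"
      using face_of_polyhedron_subset_facet[OF pP faceF(1) _ faceF(2)] by blast
    \<comment> \<open>The vertices of \<open>H\<close> form a face of the complex that contains \<open>F\<close>; as all facets
      have four vertices, it is \<open>F\<close>.\<close>
    have Hf: "H face_of P" "H \<noteq> P" using H(1) by (auto simp: facet_of_def)
    define E where "E = {v. v extreme_point_of H}"
    have EB: "E \<in> boundary_complex P" using Hf by (auto simp: E_def boundary_complex_def)
    then have "E \<subseteq> f ` V" using bij by (auto simp: bij_betw_def)
    then obtain S where S: "S \<subseteq> V" "E = f ` S" by (meson subset_image_iff)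
    then have SK: "S \<in> K" using iso EB VK by simp
    have "f ` F \<subseteq> E"
    proof
      fix z assume z: "z \<in> f ` F"
      then have "z extreme_point_of P" using ext F by (auto simp: V_def)
      moreover have "z \<in> H" using z H(2) by (auto simp: G_def hull_inc)
      ultimately show "z \<in> E" using Hf(1) by (simp add: E_def extreme_point_of_face)
    qed
    moreover have "F \<subseteq> V" using F by (auto simp: V_def)
    ultimately have "F \<subseteq> S" using S injV by (metis inj_on_image_mem_iff image_subset_iff subset_iff)
    moreover obtain F' where F': "F' \<in> \<F>" "S \<subseteq> F'" using SK by (auto simp: K_def complex_of_facets_def)
    ultimately have "F = S" using card_subset_eq[OF fin[OF F'(1)]] card[OF F] card[OF F'(1)] by (metis subset_antisym subset_trans)
    have "polytope H" using Hf(1) P face_of_polytope_polytope by blast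
    then have "H = convex hull E"
      unfolding E_def using Krein_Milman_Minkowski polytope_imp_compact polytope_imp_convex by blast
    then show ?thesis using H(1) S(2) \<open>F = S\<close> by (simp add: G_def)
  qed
  have indep: "\<not> affine_dependent (f ` F)" if F: "F \<in> \<F>" for F
  proof (rule simplex_affine_independent[OF cP])
    fix T assume "T \<subseteq> f ` F"
    then obtain T' where "T' \<subseteq> F" "T = f ` T'" by (meson subset_image_iff)
    then show "convex hull T face_of P" using face(1)[of T'] subK[OF F] KV by blast
  next
    fix v assume "v \<in> f ` F" then show "v extreme_point_of P" using ext F by (auto simp: V_def)
  qed
  have notaff: "f y \<notin> affine hull (f ` F)" if F: "F \<in> \<F>" and y: "y \<in> V - F" for F y
  proof
    assume "f y \<in> affine hull (f ` F)"
    then have "f y \<in> affine hull (G F) \<inter> P" using fP y by (simp add: G_def)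
    then have "f y \<in> G F"
      using face_of_imp_eq_affine_Int[OF cP facet_of_imp_face_of[OF facet[OF F]]] by simp
    then have "f y extreme_point_of G F"
      using facet_of_imp_face_of[OF facet[OF F]] ext y by (simp add: extreme_point_of_face)
    then have "f y \<in> f ` F" using extreme_point_of_convex_hull G_def by metis
    then show False using injV y F by (auto simp: V_def inj_on_def)
  qed
  let ?h = "\<lambda>x::'a. (x, 1::real)"
  define w where "w v = ?h (f v)" for v
  have spanF: "span (w ` insert y F) = span (w ` V)" if F: "F \<in> \<F>" and y: "y \<in> V - F" for F y
  proof
    have "insert y F \<subseteq> V" using F y by (auto simp: V_def)
    then show "span (w ` insert y F) \<subseteq> span (w ` V)" by (intro span_mono image_mono)
    have sub: "f ` insert y F \<subseteq> P" using fP \<open>insert y F \<subseteq> V\<close> by blast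
    have "aff_dim (f ` insert y F) = aff_dim (f ` F) + 1"
      using notaff[OF F y] by (simp add: aff_dim_insert)
    also have "\<dots> = aff_dim P"
      using facet[OF F] by (simp add: facet_of_def G_def aff_dim_convex_hull)
    finally have "affine hull (f ` insert y F) = affine hull P"
      using sub affine_dim_equal[of "affine hull (f ` insert y F)" "affine hull P"]
      by (simp add: hull_mono)
    then have "w v \<in> span (w ` insert y F)" if "v \<in> V" for v
      using span_homogenize[of "f v" "f ` insert y F"] fP[OF that]
      by (simp add: w_def image_image hull_inc)
    then show "span (w ` V) \<subseteq> span (w ` insert y F)" by (simp add: image_subsetI span_minimal)
  qed
  define W where "W = span (w ` V)"
  have "dim W = 5"
  proof -
    have v0: "v0 \<in> V - F0" using F0 by (simp add: V_def)
    have "independent (?h ` (f ` insert v0 F0))"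
      using indep[OF F0(1)] notaff[OF F0(1) v0] fin[OF F0(1)]
      by (intro independent_homogenize) (auto simp: affine_independent_insert)
    moreover have "card (?h ` (f ` insert v0 F0)) = card (insert v0 F0)"
      using injV F0 by (subst card_image; (subst card_image)?) (auto simp: V_def inj_on_def)
    moreover have "card (insert v0 F0) = 5" using card[OF F0(1)] F0 fin by simp
    ultimately show ?thesis
      unfolding W_def spanF[OF F0(1) v0, symmetric] w_def
      by (simp add: dim_span dim_eq_card_independent image_image del: image_insert)
  qed
  then have "dim W = dim (UNIV :: (real^Enum.finite_5) set)"
    by (simp add: Enum.UNIV_finite_5)
  then obtain g where g: "linear g" "g ` W = (UNIV :: (real^Enum.finite_5) set)"
    using isometries_subspaces[of W "UNIV :: (real^Enum.finite_5) set"] unfolding W_def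
    by (metis subspace_UNIV subspace_span)
  show ?thesis
  proof (intro exI[of _ "g \<circ> w"] allI impI)
    fix a b c d x y
    assume F: "{a, b, c, d} \<in> \<F>" and x: "x \<in> \<Union>\<F> - {a, b, c, d}" and y: "y \<in> \<Union>\<F> - {a, b, c, d}"
    let ?F = "{a, b, c, d}"
    let ?B = "bracket (g (w a)) (g (w b)) (g (w c)) (g (w d))"
    obtain n \<beta> where hyp: "P \<subseteq> {z. n \<bullet> z \<le> \<beta>}" "G ?F = P \<inter> {z. n \<bullet> z = \<beta>}"
      using exposed_face_of_polyhedron[OF pP, of "G ?F"] facet_of_imp_face_of[OF facet[OF F]]
      unfolding exposed_face_of_def by blast
    define L where "L = (\<lambda>z::'a \<times> real. \<beta> * snd z - n \<bullet> fst z)"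
    have L: "linear L" unfolding L_def by (rule linearI) (simp_all add: algebra_simps inner_add_right)
    have L0: "L z = 0" if "z \<in> w ` ?F" for z
    proof -
      obtain v where v: "v \<in> ?F" "z = w v" using \<open>z \<in> w ` ?F\<close> by blast
      then have "f v \<in> G ?F" by (auto simp: G_def hull_inc)
      then show ?thesis using hyp v by (auto simp: L_def w_def)
    qed
    have Lpos: "L (w v) > 0" if v: "v \<in> V - ?F" for v
    proof -
      have "f v \<in> P" using fP v by simp
      moreover have "f v \<notin> G ?F"
        using notaff[OF F v] convex_hull_subset_affine_hull unfolding G_def by blast
      ultimately have "n \<bullet> f v < \<beta>" using hyp by force
      then show ?thesis by (simp add: L_def w_def)
    qed
    have xV: "x \<in> V - ?F" and yV: "y \<in> V - ?F" using x y by (auto simp: V_def)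
    have "w x \<in> span (insert (w y) (w ` ?F))"
      using spanF[OF F yV] xV by (metis DiffD1 image_insert image_eqI span_base)
    \<comment> \<open>\<open>k\<close> is the quotient of the values at \<open>x\<close> and \<open>y\<close>, both of the supporting functional
      and of the bracket.\<close>
    then obtain k where k: "w x - k *\<^sub>R w y \<in> span (w ` ?F)" unfolding span_insert by blast
    then have "L (w x - k *\<^sub>R w y) = 0" using linear_eq_0_on_span[OF L L0] by blast
    then have "L (w x) = k * L (w y)" using L by (simp add: linear_diff linear_scale)
    then have "k > 0" using Lpos[OF xV] Lpos[OF yV] by (metis zero_less_mult_pos2)
    have "g (w x - k *\<^sub>R w y) \<in> span (g ` w ` ?F)"
      using k span_linear_image[OF g(1)] by blast
    then have "?B (g (w x - k *\<^sub>R w y)) = 0" by (intro bracket_eq_0_span) simp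
    then have eq: "?B (g (w x)) = k * ?B (g (w y))"
      using g(1) by (simp add: linear_diff linear_scale linear_diff[OF linear_bracket] linear_scale[OF linear_bracket])
    have "span (g ` w ` insert y ?F) = UNIV"
      by (simp only: span_linear_image[OF g(1)] spanF[OF F yV] W_def[symmetric] g(2))
    then have "?B (g (w y)) \<noteq> 0" by (simp add: bracket_nonzero_iff insert_commute)
    then show "0 < bracket ((g \<circ> w) a) ((g \<circ> w) b) ((g \<circ> w) c) ((g \<circ> w) d) ((g \<circ> w) x) *
       bracket ((g \<circ> w) a) ((g \<circ> w) b) ((g \<circ> w) c) ((g \<circ> w) d) ((g \<circ> w) y)"
      using \<open>k > 0\<close> by (auto simp: eq zero_less_mult_iff mult_less_0_iff linorder_neq_iff)
  qed
qed

section \<open>Facets common to all large members of the family\<close>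

lemma B31_facets_eq:
  "B31_facets n = (\<lambda>e. e \<union> {n - 1, n}) `
     ((\<lambda>i. {- i, - (i + 1)}) ` {1..n - 3} \<union> (\<lambda>i. {i, i + 1}) ` {1..n - 3} \<union> {{- (n - 2), 1}}) \<union>
   {{1, - (n - 2), - (n - 1), n}, {1, - (n - 2), - (n - 1), - n}}"
proof -
  have *: "{f i |i. 1 \<le> i \<and> i \<le> k} = f ` {1..k}" for f :: "int \<Rightarrow> int set" and k by auto
  have **: "{e \<union> X |e. e \<in> E} = (\<lambda>e. e \<union> X) ` E" for X :: "int set" and E by auto
  show ?thesis unfolding B31_facets_def consecutive_pairs_def * ** ..
qed

lemma int_intervals: "{1..2::int} = {1, 2}" "{1..3::int} = {1, 2, 3}"
  by auto

lemma B31_facets_4: "B31_facets 4 =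
    {{1, -2, -3, 4}, {1, -2, -3, -4}, {3, 4, -2, 1}, {3, 4, 1, 2}, {3, 4, -1, -2}}"
  by (simp add: B31_facets_eq)

lemma B31_facets_5: "B31_facets 5 =
    {{1, -3, -4, 5}, {1, -3, -4, -5}, {4, 5, -3, 1}, {4, 5, 1, 2}, {4, 5, 2, 3},
     {4, 5, -1, -2}, {4, 5, -2, -3}}"
  by (simp add: B31_facets_eq int_intervals)

lemma B31_facets_6: "B31_facets 6 =
    {{1, -4, -5, 6}, {1, -4, -5, -6}, {5, 6, -4, 1}, {5, 6, 1, 2}, {5, 6, 2, 3}, {5, 6, 3, 4},
     {5, 6, -1, -2}, {5, 6, -2, -3}, {5, 6, -3, -4}}"
  by (simp add: B31_facets_eq int_intervals)

lemma boundary_triangleI: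
  assumes "card T = 3" "F \<in> \<F>" "T \<subseteq> F" "\<forall>G\<in>\<F>. T \<subseteq> G \<longrightarrow> G = F"
  shows "T \<in> boundary_triangles \<F>"
proof -
  have "\<exists>!F. F \<in> \<F> \<and> T \<subseteq> F" using assms(2-4) by (intro ex1I[of _ F]) blast+
  then show ?thesis using assms(1) by (simp add: boundary_triangles_def)
qed

lemma mem_neg_facets_iff: "F \<in> neg_facets \<F> \<longleftrightarrow> uminus ` F \<in> \<F>"
  unfolding neg_facets_def by (auto simp: image_image intro: image_eqI[of _ _ "uminus ` F"])

lemma Delta3_facets_step:
  assumes "n \<ge> 4"
  shows "F \<in> Delta3_facets (Suc n) \<longleftrightarrow>
    F \<in> Delta3_facets n \<and> F \<notin> B31_facets (int n) \<and> uminus ` F \<notin> B31_facets (int n) \<or>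
    (\<exists>T \<in> boundary_triangles (B31_facets (int n)). F = T \<union> {int n + 1} \<or> F = uminus ` T \<union> {- (int n + 1)})"
  using assms by (auto simp: mem_neg_facets_iff)

lemma uminus_mem_cross_polytope:
  assumes "F \<in> cross_polytope_facets"
  shows "uminus ` F \<in> cross_polytope_facets"
proof -
  obtain a b c d where *: "F = {a * 1, b * 2, c * 3, d * 4}" "a \<in> {1, -1}" "b \<in> {1, -1}" "c \<in> {1, -1}" "d \<in> {1, -1}"
    using assms unfolding cross_polytope_facets_def mem_Collect_eq by (elim exE conjE)
  then have "uminus ` F = {(- a) * 1, (- b) * 2, (- c) * 3, (- d) * 4}" by simp
  moreover have "- a \<in> {1, -1}" "- b \<in> {1, -1}" "- c \<in> {1, -1}" "- d \<in> {1, -1}" using * by auto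
  ultimately show ?thesis unfolding cross_polytope_facets_def by (intro CollectI exI conjI)
qed

lemma uminus_mem_Delta3:
  assumes "n \<ge> 4" "F \<in> Delta3_facets n"
  shows "uminus ` F \<in> Delta3_facets n"
  using assms
proof (induction n arbitrary: F rule: dec_induct)
  case base
  then show ?case using uminus_mem_cross_polytope Delta3_facets_4 by metis
next
  case (step n)
  have *: "uminus ` (T \<union> {int n + 1}) = uminus ` T \<union> {- (int n + 1)}"
    "uminus ` (uminus ` T \<union> {- (int n + 1)}) = T \<union> {int n + 1}" for T
    by (auto simp: image_image)
  have "uminus ` uminus ` F = F" by (simp add: image_image)
  then show ?case
    using step.prems step.IH[of F] unfolding Delta3_facets_step[OF step.hyps(1)] by (metis *)
qed

lemma B31_facets_abs_le: "\<lbrakk>F \<in> B31_facets n; n \<ge> 4; v \<in> F\<rbrakk> \<Longrightarrow> \<bar>v\<bar> \<le> n"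
  by (auto simp: B31_facets_eq)

lemma B31_facets_max: "F \<in> B31_facets n \<Longrightarrow> n \<in> F \<or> - n \<in> F"
  by (auto simp: B31_facets_eq)

lemma card_Delta3:
  assumes "n \<ge> 4" "F \<in> Delta3_facets n"
  shows "card F = 4"
  using assms
proof (induction n arbitrary: F rule: dec_induct)
  case base
  then show ?case unfolding Delta3_facets_4 cross_polytope_facets_def by auto
next
  case (step n)
  have "card T = 3 \<and> finite T \<and> int n + 1 \<notin> T" if T: "T \<in> boundary_triangles (B31_facets (int n))" for T
  proof -
    have "card T = 3" using T by (simp add: boundary_triangles_def)
    moreover from this have "finite T" by (simp add: card_ge_0_finite)
    moreover obtain G where "G \<in> B31_facets (int n)" "T \<subseteq> G"
      using T unfolding boundary_triangles_def by blast
    ultimately show ?thesis using B31_facets_abs_le[of G "int n"] step.hyps by fastforce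
  qed
  note bt = this
  consider "F \<in> Delta3_facets n"
    | T where "T \<in> boundary_triangles (B31_facets (int n))" "F = insert (int n + 1) T"
    | T where "T \<in> boundary_triangles (B31_facets (int n))" "F = uminus ` insert (int n + 1) T"
    using step.prems unfolding Delta3_facets_step[OF step.hyps(1)] by auto
  then show ?case
    by cases (use bt step.IH in \<open>simp_all add: card_image inj_on_def del: image_insert\<close>)
qed

text \<open>
  Every facet of the ball \<open>B31_facets n\<close> contains \<open>n\<close> or \<open>-n\<close>.  A facet that is present at
  stage \<open>m\<close>, with labels at most \<open>m\<close> in absolute value, can therefore only be removed in the step
  from \<open>m\<close> to \<open>m + 1\<close>.
\<close>

lemma Delta3_facets_persist:
  assumes "F \<in> Delta3_facets m" "m \<ge> 4" "\<forall>v\<in>F. \<bar>v\<bar> \<le> int m"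
    and "F \<notin> B31_facets (int m)" "uminus ` F \<notin> B31_facets (int m)" "n \<ge> m"
  shows "F \<in> Delta3_facets n"
  using \<open>n \<ge> m\<close>
proof (induction n rule: dec_induct)
  case base
  show ?case by (fact assms(1))
next
  case (step n)
  have "F \<notin> B31_facets (int n) \<and> uminus ` F \<notin> B31_facets (int n)"
  proof (cases "n = m")
    case True
    then show ?thesis using assms by simp
  next
    case False
    then have "int n \<notin> F" "- int n \<notin> F" using step.hyps assms(3) by fastforce+
    then show ?thesis using B31_facets_max[of F "int n"] B31_facets_max[of "uminus ` F" "int n"] by auto
  qed
  then show ?case using step assms(2) by (simp only: Delta3_facets_step) simp
qed

text \<open>
  Fifteen facets with labels between \<open>-6\<close> and \<open>6\<close>; together with their antipodes they occur in the
  complex for every \<open>n \<ge> 6\<close>.  The order of the labels records an orientation: two of these facets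
  that share a triangle induce opposite orientations on it.
\<close>

definition oriented_stable_facets :: "(int \<times> int \<times> int \<times> int) set" where
  "oriented_stable_facets =
    {(2, 1, -3, 4), (-1, 2, -3, 4), (-2, -1, -3, 4), (-5, 2, 1, -3), (-5, -1, 2, -3),
     (-5, 2, -1, 4), (-5, -2, -1, -3), (-5, 3, 2, 4), (6, -3, -4, -5), (6, 1, -3, -5),
     (6, -3, 1, 4), (6, -1, -2, 4), (6, -2, -3, 4), (6, 2, 3, 4), (6, 1, 2, 4)}"

definition stable_facets :: "int set set" where
  "stable_facets = (\<lambda>(a, b, c, d). {a, b, c, d}) ` oriented_stable_facets"

lemma cross_polytope_facetI:
  "\<lbrakk>a \<in> {1, -1}; b \<in> {2, -2}; c \<in> {3, -3}; d \<in> {4, -4}\<rbrakk> \<Longrightarrow> {a, b, c, d} \<in> cross_polytope_facets"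
  unfolding cross_polytope_facets_def
  \<comment> \<open>The divisions recover the signs from the signed labels.\<close>
  by (rule CollectI, rule exI[of _ a], rule exI[of _ "b div 2"], rule exI[of _ "c div 3"],
      rule exI[of _ "d div 4"]) auto

lemma boundary_triangles_B31_4:
  "{{-2, -1, 3}, {1, -2, 3}, {-2, 1, -4}, {2, 1, 3}, {-3, -2, -4}} \<subseteq> boundary_triangles (B31_facets 4)"
proof -
  have "{-2, -1, 3} \<in> boundary_triangles (B31_facets 4)"
    by (rule boundary_triangleI[where F = "{3, 4, -1, -2}"]; simp add: B31_facets_4)
  moreover have "{1, -2, 3} \<in> boundary_triangles (B31_facets 4)"
    by (rule boundary_triangleI[where F = "{3, 4, -2, 1}"]; simp add: B31_facets_4)
  moreover have "{-2, 1, -4} \<in> boundary_triangles (B31_facets 4)"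
    by (rule boundary_triangleI[where F = "{1, -2, -3, -4}"]; simp add: B31_facets_4)
  moreover have "{2, 1, 3} \<in> boundary_triangles (B31_facets 4)"
    by (rule boundary_triangleI[where F = "{3, 4, 1, 2}"]; simp add: B31_facets_4)
  moreover have "{-3, -2, -4} \<in> boundary_triangles (B31_facets 4)"
    by (rule boundary_triangleI[where F = "{1, -2, -3, -4}"]; simp add: B31_facets_4)
  ultimately show ?thesis by simp
qed

lemma boundary_triangles_B31_5:
  "{{-3, -4, -5}, {1, -3, -5}, {-3, 1, 4}, {-1, -2, 4}, {-2, -3, 4},
    {2, 3, 4}, {1, 2, 4}} \<subseteq> boundary_triangles (B31_facets 5)"
proof -
  have "{-3, -4, -5} \<in> boundary_triangles (B31_facets 5)"
    by (rule boundary_triangleI[where F = "{1, -3, -4, -5}"]; simp add: B31_facets_5)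
  moreover have "{1, -3, -5} \<in> boundary_triangles (B31_facets 5)"
    by (rule boundary_triangleI[where F = "{1, -3, -4, -5}"]; simp add: B31_facets_5)
  moreover have "{-3, 1, 4} \<in> boundary_triangles (B31_facets 5)"
    by (rule boundary_triangleI[where F = "{4, 5, -3, 1}"]; simp add: B31_facets_5)
  moreover have "{-1, -2, 4} \<in> boundary_triangles (B31_facets 5)"
    by (rule boundary_triangleI[where F = "{4, 5, -1, -2}"]; simp add: B31_facets_5)
  moreover have "{-2, -3, 4} \<in> boundary_triangles (B31_facets 5)"
    by (rule boundary_triangleI[where F = "{4, 5, -2, -3}"]; simp add: B31_facets_5)
  moreover have "{2, 3, 4} \<in> boundary_triangles (B31_facets 5)"
    by (rule boundary_triangleI[where F = "{4, 5, 2, 3}"]; simp add: B31_facets_5)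
  moreover have "{1, 2, 4} \<in> boundary_triangles (B31_facets 5)"
    by (rule boundary_triangleI[where F = "{4, 5, 1, 2}"]; simp add: B31_facets_5)
  ultimately show ?thesis by simp
qed

lemma Delta3_facets_newI:
  assumes "n \<ge> 4" "T \<in> boundary_triangles (B31_facets (int n))"
  shows "insert (int n + 1) T \<in> Delta3_facets (Suc n)"
    "insert (- (int n + 1)) (uminus ` T) \<in> Delta3_facets (Suc n)"
  unfolding Delta3_facets_step[OF assms(1)] using assms(2) by blast+

lemma Delta3_facets_5I:
  "T \<in> boundary_triangles (B31_facets 4) \<Longrightarrow> insert (- 5) (uminus ` T) \<in> Delta3_facets 5"
  using Delta3_facets_newI(2)[of 4 T] by simp

lemma Delta3_facets_6I:
  "T \<in> boundary_triangles (B31_facets 5) \<Longrightarrow> insert 6 T \<in> Delta3_facets 6"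
  using Delta3_facets_newI(1)[of 5 T] by simp

text \<open>
  Three of the facets belong to the cross-polytope, five appear together with the vertex \<open>-5\<close> and
  seven together with the vertex \<open>6\<close>.  If \<open>m\<close> is the first stage at which a facet is present, its
  labels are at most \<open>m\<close> in absolute value, so only the balls removed from stage \<open>m\<close> have to be
  inspected.
\<close>

lemma stable_facets_subset:
  assumes "n \<ge> 6"
  shows "stable_facets \<subseteq> Delta3_facets n"
proof -
  have old: "F \<in> Delta3_facets n" if F: "F \<in> {{2, 1, -3, 4}, {-1, 2, -3, 4}, {-2, -1, -3, 4}}" for F
  proof (rule Delta3_facets_persist[of F 4])
    show "F \<in> Delta3_facets 4"
      using F cross_polytope_facetI[of _ 2 "-3" 4] cross_polytope_facetI[of _ "-2" "-3" 4]
      by (auto simp: Delta3_facets_4 insert_commute[of 2 1] insert_commute[of "-2" "-1"])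
    show "F \<notin> B31_facets (int 4)" "uminus ` F \<notin> B31_facets (int 4)"
      using F unfolding of_nat_numeral B31_facets_4
      by (elim insertE emptyE; hypsubst; simp add: set_eq_subset)+
  qed (use F assms in auto)
  have new5: "F \<in> Delta3_facets n"
    if F: "F \<in> {{-5, 2, 1, -3}, {-5, -1, 2, -3}, {-5, 2, -1, 4}, {-5, -2, -1, -3},
        {-5, 3, 2, 4}}" for F
  proof (rule Delta3_facets_persist[of F 5])
    have "F \<in> (\<lambda>T. insert (- 5) (uminus ` T)) `
        {{-2, -1, 3}, {1, -2, 3}, {-2, 1, -4}, {2, 1, 3}, {-3, -2, -4}}"
      using F by simp
    then show "F \<in> Delta3_facets 5"
      using boundary_triangles_B31_4 Delta3_facets_5I by blast
    show "F \<notin> B31_facets (int 5)" "uminus ` F \<notin> B31_facets (int 5)"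
      using F unfolding of_nat_numeral B31_facets_5
      by (elim insertE emptyE; hypsubst; simp add: set_eq_subset)+
  qed (use F assms in auto)
  have new6: "F \<in> Delta3_facets n"
    if F: "F \<in> {{6, -3, -4, -5}, {6, 1, -3, -5}, {6, -3, 1, 4}, {6, -1, -2, 4},
        {6, -2, -3, 4}, {6, 2, 3, 4}, {6, 1, 2, 4}}" for F
  proof (rule Delta3_facets_persist[of F 6])
    have "F \<in> (insert 6) `
        {{-3, -4, -5}, {1, -3, -5}, {-3, 1, 4}, {-1, -2, 4}, {-2, -3, 4},
         {2, 3, 4}, {1, 2, 4}}"
      using F by simp
    then show "F \<in> Delta3_facets 6"
      using boundary_triangles_B31_5 Delta3_facets_6I by blast
    show "F \<notin> B31_facets (int 6)" "uminus ` F \<notin> B31_facets (int 6)"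
      using F unfolding of_nat_numeral B31_facets_6
      by (elim insertE emptyE; hypsubst; simp add: set_eq_subset)+
  qed (use F assms in auto)
  show ?thesis
    unfolding stable_facets_def oriented_stable_facets_def image_insert image_empty split insert_subset
    by (intro conjI empty_subsetI;
      ((rule old, (simp; fail)) | (rule new5, (simp; fail)) | (rule new6, (simp; fail))))
qed

section \<open>Orienting the common facets\<close>

abbreviation core_vertices :: "int set" where "core_vertices \<equiv> {- 6..6} - {0}"

text \<open>
  A sign pattern in which each of the fifteen facets, in its listed order, is positive together with
  any further label.
\<close>

definition coherent :: "(int \<Rightarrow> int \<Rightarrow> int \<Rightarrow> int \<Rightarrow> int \<Rightarrow> real) \<Rightarrow> bool" where
  "coherent D \<longleftrightarrow>
    (\<forall>(a, b, c, d) \<in> oriented_stable_facets. \<forall>x \<in> core_vertices - {a, b, c, d}. 0 < D a b c d x)"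

lemma coherentD:
  "\<lbrakk>coherent D; (a, b, c, d) \<in> oriented_stable_facets; x \<in> core_vertices - {a, b, c, d}\<rbrakk>
    \<Longrightarrow> 0 < D a b c d x"
  unfolding coherent_def by (drule (1) bspec) simp

text \<open>
  The properties of the brackets of labelled vectors that the sign arguments rely on.  They are
  preserved by a change of sign and by the antipodal relabelling \<open>v \<mapsto> - v\<close>, which makes it enough to
  treat the fifteen facets and to apply the result to the antipodal brackets.
\<close>

locale chirotope =
  fixes D :: "int \<Rightarrow> int \<Rightarrow> int \<Rightarrow> int \<Rightarrow> int \<Rightarrow> real"
  assumes swap:
      "D b a c d e = - D a b c d e" "D a c b d e = - D a b c d e"
      "D a b d c e = - D a b c d e" "D a b c e d = - D a b c d e"
    and three_term:
      "D p q r a c * D p q r b d = D p q r a b * D p q r c d + D p q r a d * D p q r b c"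
begin

lemma sort_args:
  "b < a \<Longrightarrow> D a b c d e = - D b a c d e"
  "c < b \<Longrightarrow> D a b c d e = - D a c b d e"
  "d < c \<Longrightarrow> D a b c d e = - D a b d c e"
  "e < d \<Longrightarrow> D a b c d e = - D a b c e d"
  by (rule swap)+

text \<open>
  For concrete labels these rules bring the arguments of a bracket into increasing order.
  In a context with contradictory sign facts, linear arithmetic would prove the side conditions
  for any two labels and rewriting would not end; there the rules are applied with
  \<^verbatim>\<open>simp only\<close>.
\<close>

lemmas sort = sort_args rel_simps neg_less_iff_less

lemmas mult_signs = mult_pos_pos mult_neg_neg mult_pos_neg mult_neg_pos

lemma three_term_pos:
  "\<lbrakk>0 < D p q r a b * D p q r c d; 0 < D p q r a d * D p q r b c\<rbrakk>
    \<Longrightarrow> 0 < D p q r a c * D p q r b d"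
  by (subst three_term) (rule add_pos_pos)

end

locale facet_chirotope = chirotope +
  fixes \<F> :: "int set set"
  assumes same_side:
    "\<lbrakk>{a, b, c, d} \<in> \<F>; x \<in> core_vertices - {a, b, c, d}; y \<in> core_vertices - {a, b, c, d}\<rbrakk>
      \<Longrightarrow> 0 < D a b c d x * D a b c d y"
begin

definition positive :: "int \<Rightarrow> int \<Rightarrow> int \<Rightarrow> int \<Rightarrow> bool" where
  "positive a b c d \<longleftrightarrow> (\<forall>x \<in> core_vertices - {a, b, c, d}. 0 < D a b c d x)"

lemma positiveD: "\<lbrakk>positive a b c d; x \<in> core_vertices - {a, b, c, d}\<rbrakk> \<Longrightarrow> 0 < D a b c d x"
  by (simp add: positive_def)

lemma positiveI:
  assumes "{a, b, c, d} \<in> \<F>" "y \<in> core_vertices - {a, b, c, d}" "0 < D a b c d y"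
  shows "positive a b c d"
  unfolding positive_def using same_side[OF assms(1) _ assms(2)] assms(3)
  by (meson zero_less_mult_pos2)

text \<open>
  If \<open>d\<close> is replaced by \<open>e\<close> in a facet \<open>{a, b, c, d}\<close>, both facets control the same bracket
  \<open>D a b c d e\<close>, and a positive sign passes from one to the other.  The steps follow a spanning tree
  of the adjacency graph of the fifteen facets.
\<close>

lemma coherent_if_positive:
  assumes "stable_facets \<subseteq> \<F>" and p0: "positive (-1) 2 (-3) 4"
  shows "coherent D"
proof -
  note mem = assms(1)[unfolded stable_facets_def oriented_stable_facets_def image_insert split insert_subset]
  have p1: "positive 2 1 (-3) 4"
    by (rule positiveI[where y = "-1"])
      (use positiveD[OF p0, of "1"] mem in \<open>simp_all add: sort_args insert_commute\<close>)
  have p2: "positive (-2) (-1) (-3) 4"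
    by (rule positiveI[where y = "2"])
      (use positiveD[OF p0, of "-2"] mem in \<open>simp_all add: sort_args insert_commute\<close>)
  have p3: "positive (-5) 2 1 (-3)"
    by (rule positiveI[where y = "4"])
      (use positiveD[OF p1, of "-5"] mem in \<open>simp_all add: sort_args insert_commute\<close>)
  have p4: "positive (-5) (-1) 2 (-3)"
    by (rule positiveI[where y = "4"])
      (use positiveD[OF p0, of "-5"] mem in \<open>simp_all add: sort_args insert_commute\<close>)
  have p5: "positive (-5) 2 (-1) 4"
    by (rule positiveI[where y = "-3"])
      (use positiveD[OF p0, of "-5"] mem in \<open>simp_all add: sort_args insert_commute\<close>)
  have p6: "positive (-5) (-2) (-1) (-3)"
    by (rule positiveI[where y = "4"])
      (use positiveD[OF p2, of "-5"] mem in \<open>simp_all add: sort_args insert_commute\<close>)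
  have p7: "positive (-5) 3 2 4"
    by (rule positiveI[where y = "-1"])
      (use positiveD[OF p5, of "3"] mem in \<open>simp_all add: sort_args insert_commute\<close>)
  have p8: "positive 6 1 (-3) (-5)"
    by (rule positiveI[where y = "2"])
      (use positiveD[OF p3, of "6"] mem in \<open>simp_all add: sort_args insert_commute\<close>)
  have p9: "positive 6 (-3) (-4) (-5)"
    by (rule positiveI[where y = "1"])
      (use positiveD[OF p8, of "-4"] mem in \<open>simp_all add: sort_args insert_commute\<close>)
  have p10: "positive 6 (-3) 1 4"
    by (rule positiveI[where y = "2"])
      (use positiveD[OF p1, of "6"] mem in \<open>simp_all add: sort_args insert_commute\<close>)
  have p11: "positive 6 (-1) (-2) 4"
    by (rule positiveI[where y = "-3"])
      (use positiveD[OF p2, of "6"] mem in \<open>simp_all add: sort_args insert_commute\<close>)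
  have p12: "positive 6 (-2) (-3) 4"
    by (rule positiveI[where y = "-1"])
      (use positiveD[OF p2, of "6"] mem in \<open>simp_all add: sort_args insert_commute\<close>)
  have p13: "positive 6 2 3 4"
    by (rule positiveI[where y = "-5"])
      (use positiveD[OF p7, of "6"] mem in \<open>simp_all add: sort_args insert_commute\<close>)
  have p14: "positive 6 1 2 4"
    by (rule positiveI[where y = "-3"])
      (use positiveD[OF p1, of "6"] mem in \<open>simp_all add: sort_args insert_commute\<close>)
  show ?thesis
    unfolding coherent_def oriented_stable_facets_def
    using p0 p1 p2 p3 p4 p5 p6 p7 p8 p9 p10 p11 p12 p13 p14 by (simp add: positive_def)
qed

lemma facet_chirotope_uminus: "facet_chirotope (\<lambda>a b c d e. - D a b c d e) \<F>"
  by unfold_locales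
    (unfold minus_mult_minus, (rule arg_cong[OF swap(1)] arg_cong[OF swap(2)] arg_cong[OF swap(3)]
      arg_cong[OF swap(4)] three_term | erule (2) same_side)+)

lemma facet_chirotope_antipodal:
  assumes "\<And>F. F \<in> \<F> \<Longrightarrow> uminus ` F \<in> \<F>"
  shows "facet_chirotope (\<lambda>a b c d e. D (- a) (- b) (- c) (- d) (- e)) \<F>"
proof unfold_locales
  fix a b c d x y
  assume F: "{a, b, c, d} \<in> \<F>"
    and x: "x \<in> core_vertices - {a, b, c, d}" and y: "y \<in> core_vertices - {a, b, c, d}"
  have core: "- z \<in> core_vertices - {- a, - b, - c, - d}" if "z \<in> core_vertices - {a, b, c, d}" for z
    using that by simp
  have "{- a, - b, - c, - d} \<in> \<F>" using assms[OF F] by simp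
  then show "0 < D (- a) (- b) (- c) (- d) (- x) * D (- a) (- b) (- c) (- d) (- y)"
    by (rule same_side[OF _ core[OF x] core[OF y]])
qed (rule swap three_term)+

lemma coherent_or_opposite:
  assumes "stable_facets \<subseteq> \<F>"
  shows "coherent D \<or> coherent (\<lambda>a b c d e. - D a b c d e)"
proof -
  interpret neg: facet_chirotope "\<lambda>a b c d e. - D a b c d e" \<F> by (rule facet_chirotope_uminus)
  have mem: "{-1, 2, -3, 4} \<in> \<F>"
    using assms by (simp add: stable_facets_def oriented_stable_facets_def)
  have "D (-1) 2 (-3) 4 1 \<noteq> 0" using same_side[OF mem, of 1 1] by auto
  then have "positive (-1) 2 (-3) 4 \<or> neg.positive (-1) 2 (-3) 4"
    using positiveI[OF mem, of 1] neg.positiveI[OF mem, of 1] by fastforce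
  then show ?thesis using coherent_if_positive[OF assms] neg.coherent_if_positive[OF assms] by blast
qed

end

section \<open>Sign contradictions\<close>

text \<open>
  The two refutations are sign certificates.  The first facts of each proof are read off from a
  facet or from the antipode of a facet.  Then each product is the left-hand side of a three-term
  relation whose arguments are ordered so that both products on the right are positive, and it
  determines the sign of one new bracket.  In the last relation both brackets on the left are already
  known, and they have opposite signs.
\<close>

context chirotope
begin

lemma not_coherent_opposite:
  assumes pos: "coherent D" and anti: "coherent (\<lambda>a b c d e. - D (- a) (- b) (- c) (- d) (- e))"
  shows False
proof -
  \<comment> \<open>Brackets that contain a facet.\<close>
  have "0 < D (-5) (-2) (-1) 4 6"
    using coherentD[OF pos, of 6 "-1" "-2" 4 "-5"] by (simp add: oriented_stable_facets_def sort_args)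
  have "D (-1) 1 2 4 6 < 0"
    using coherentD[OF pos, of 6 1 2 4 "-1"] by (simp add: oriented_stable_facets_def sort_args)
  have "0 < D (-2) (-1) 2 4 6"
    using coherentD[OF pos, of 6 "-1" "-2" 4 2] by (simp add: oriented_stable_facets_def sort_args)
  have "D (-5) (-1) 2 4 6 < 0"
    using coherentD[OF pos, of "-5" 2 "-1" 4 6] by (simp add: oriented_stable_facets_def sort_args)
  have "0 < D (-2) (-1) 1 4 6"
    using coherentD[OF pos, of 6 "-1" "-2" 4 1] by (simp add: oriented_stable_facets_def sort_args)
  have "0 < D (-3) (-1) 2 4 6"
    using coherentD[OF pos, of "-1" 2 "-3" 4 6] by (simp add: oriented_stable_facets_def sort_args)
  have "0 < D (-3) (-2) (-1) 4 6"
    using coherentD[OF pos, of "-2" "-1" "-3" 4 6] by (simp add: oriented_stable_facets_def sort_args)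
  have "0 < D (-5) (-3) (-2) (-1) 6"
    using coherentD[OF pos, of "-5" "-2" "-1" "-3" 6] by (simp add: oriented_stable_facets_def sort_args)
  have "0 < D (-5) (-3) (-1) 1 6"
    using coherentD[OF pos, of 6 1 "-3" "-5" "-1"] by (simp add: oriented_stable_facets_def sort_args)
  have "0 < D (-4) (-2) (-1) 3 6"
    using coherentD[OF anti, of 2 1 "-3" 4 "-6"] by (simp add: oriented_stable_facets_def sort_args)
  have "D (-2) (-1) 4 5 6 < 0"
    using coherentD[OF pos, of 6 "-1" "-2" 4 5] by (simp add: oriented_stable_facets_def sort_args)
  have "0 < D (-4) (-2) (-1) 4 6"
    using coherentD[OF pos, of 6 "-1" "-2" 4 "-4"] by (simp add: oriented_stable_facets_def sort_args)
  have "0 < D (-2) (-1) 3 5 6"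
    using coherentD[OF anti, of "-5" 2 1 "-3" "-6"] by (simp add: oriented_stable_facets_def sort_args)
  have "0 < D (-2) (-1) 3 4 6"
    using coherentD[OF pos, of 6 "-1" "-2" 4 3] by (simp add: oriented_stable_facets_def sort_args)
  have "0 < D (-4) (-2) (-1) 1 5"
    using coherentD[OF anti, of "-5" 2 "-1" 4 1] by (simp add: oriented_stable_facets_def sort_args)
  have "0 < D (-4) (-2) (-1) 3 5"
    using coherentD[OF anti, of "-5" 2 1 "-3" 4] by (simp add: oriented_stable_facets_def sort_args)
  have "0 < D (-2) (-1) 1 3 5"
    using coherentD[OF anti, of "-5" 2 1 "-3" "-1"] by (simp add: oriented_stable_facets_def sort_args)
  have "0 < D (-5) (-3) (-2) (-1) 5"
    using coherentD[OF pos, of "-5" "-2" "-1" "-3" 5] by (simp add: oriented_stable_facets_def sort_args)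
  have "D (-2) (-1) 3 4 5 < 0"
    using coherentD[OF anti, of "-5" 2 1 "-3" "-4"] by (simp add: oriented_stable_facets_def sort_args)
  have "0 < D (-5) (-2) (-1) 3 5"
    using coherentD[OF anti, of "-5" 2 1 "-3" 5] by (simp add: oriented_stable_facets_def sort_args)
  have "0 < D (-3) (-2) (-1) 4 5"
    using coherentD[OF pos, of "-2" "-1" "-3" 4 5] by (simp add: oriented_stable_facets_def sort_args)
  have "0 < D (-3) (-2) (-1) 3 5"
    using coherentD[OF anti, of "-5" 2 1 "-3" 3] by (simp add: oriented_stable_facets_def sort_args)
  \<comment> \<open>Brackets whose signs are forced by three-term relations.\<close>
  have "0 < D (-1) 4 6 (-5) 1 * D (-1) 4 6 2 (-2)"
    by (rule three_term_pos)
      (use \<open>D (-5) (-1) 2 4 6 < 0\<close> \<open>0 < D (-2) (-1) 1 4 6\<close> \<open>0 < D (-5) (-2) (-1) 4 6\<close> \<open>D (-1) 1 2 4 6 < 0\<close>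
       in \<open>simp_all only: sort, simp_all add: mult_signs\<close>)
  then have "D (-5) (-1) 1 4 6 < 0"
    using \<open>0 < D (-2) (-1) 2 4 6\<close> by (simp only: sort) (simp add: zero_less_mult_iff mult_less_0_iff)
  have "0 < D (-1) 4 6 (-5) (-3) * D (-1) 4 6 2 (-2)"
    by (rule three_term_pos)
      (use \<open>D (-5) (-1) 2 4 6 < 0\<close> \<open>0 < D (-3) (-2) (-1) 4 6\<close> \<open>0 < D (-5) (-2) (-1) 4 6\<close> \<open>0 < D (-3) (-1) 2 4 6\<close>
       in \<open>simp_all only: sort, simp_all add: mult_signs\<close>)
  then have "0 < D (-5) (-3) (-1) 4 6"
    using \<open>0 < D (-2) (-1) 2 4 6\<close> by (simp only: sort) (simp add: zero_less_mult_iff mult_less_0_iff)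
  have "0 < D (-5) (-1) 6 (-3) 4 * D (-5) (-1) 6 (-2) 1"
    by (rule three_term_pos)
      (use \<open>0 < D (-5) (-3) (-2) (-1) 6\<close> \<open>D (-5) (-1) 1 4 6 < 0\<close> \<open>0 < D (-5) (-3) (-1) 1 6\<close> \<open>0 < D (-5) (-2) (-1) 4 6\<close>
       in \<open>simp_all only: sort, simp_all add: mult_signs\<close>)
  then have "0 < D (-5) (-2) (-1) 1 6"
    using \<open>0 < D (-5) (-3) (-1) 4 6\<close> by (simp only: sort) (simp add: zero_less_mult_iff mult_less_0_iff)
  have "0 < D (-2) (-1) 6 (-4) 5 * D (-2) (-1) 6 3 4"
    by (rule three_term_pos)
      (use \<open>0 < D (-4) (-2) (-1) 3 6\<close> \<open>D (-2) (-1) 4 5 6 < 0\<close> \<open>0 < D (-4) (-2) (-1) 4 6\<close> \<open>0 < D (-2) (-1) 3 5 6\<close>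
       in \<open>simp_all only: sort, simp_all add: mult_signs\<close>)
  then have "0 < D (-4) (-2) (-1) 5 6"
    using \<open>0 < D (-2) (-1) 3 4 6\<close> by (simp only: sort) (simp add: zero_less_mult_iff mult_less_0_iff)
  have "0 < D (-2) (-1) 5 (-4) 3 * D (-2) (-1) 5 6 1"
    by (rule three_term_pos)
      (use \<open>0 < D (-4) (-2) (-1) 5 6\<close> \<open>0 < D (-2) (-1) 1 3 5\<close> \<open>0 < D (-4) (-2) (-1) 1 5\<close> \<open>0 < D (-2) (-1) 3 5 6\<close>
       in \<open>simp_all only: sort, simp_all add: mult_signs\<close>)
  then have "0 < D (-2) (-1) 1 5 6"
    using \<open>0 < D (-4) (-2) (-1) 3 5\<close> by (simp only: sort) (simp add: zero_less_mult_iff mult_less_0_iff)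
  have "0 < D (-2) (-1) 5 (-5) 4 * D (-2) (-1) 5 (-3) 3"
    by (rule three_term_pos)
      (use \<open>0 < D (-5) (-3) (-2) (-1) 5\<close> \<open>D (-2) (-1) 3 4 5 < 0\<close> \<open>0 < D (-5) (-2) (-1) 3 5\<close> \<open>0 < D (-3) (-2) (-1) 4 5\<close>
       in \<open>simp_all only: sort, simp_all add: mult_signs\<close>)
  then have "0 < D (-5) (-2) (-1) 4 5"
    using \<open>0 < D (-3) (-2) (-1) 3 5\<close> by (simp only: sort) (simp add: zero_less_mult_iff mult_less_0_iff)
  have "0 < D (-2) (-1) 5 (-5) 6 * D (-2) (-1) 5 4 3"
    by (rule three_term_pos)
      (use \<open>0 < D (-5) (-2) (-1) 4 5\<close> \<open>0 < D (-2) (-1) 3 5 6\<close> \<open>0 < D (-5) (-2) (-1) 3 5\<close> \<open>D (-2) (-1) 4 5 6 < 0\<close>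
       in \<open>simp_all only: sort, simp_all add: mult_signs\<close>)
  then have "D (-5) (-2) (-1) 5 6 < 0"
    using \<open>D (-2) (-1) 3 4 5 < 0\<close> by (simp only: sort) (simp add: zero_less_mult_iff mult_less_0_iff)
  have "0 < D (-2) (-1) 6 (-5) 5 * D (-2) (-1) 6 1 4"
    by (rule three_term_pos)
      (use \<open>0 < D (-5) (-2) (-1) 1 6\<close> \<open>D (-2) (-1) 4 5 6 < 0\<close> \<open>0 < D (-5) (-2) (-1) 4 6\<close> \<open>0 < D (-2) (-1) 1 5 6\<close>
       in \<open>simp_all only: sort, simp_all add: mult_signs\<close>)
  then show False
    using \<open>D (-5) (-2) (-1) 5 6 < 0\<close> \<open>0 < D (-2) (-1) 1 4 6\<close> by (simp only: sort) (simp add: zero_less_mult_iff mult_less_0_iff)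
qed

lemma not_coherent_same:
  assumes pos: "coherent D" and anti: "coherent (\<lambda>a b c d e. D (- a) (- b) (- c) (- d) (- e))"
  shows False
proof -
  \<comment> \<open>Brackets that contain a facet.\<close>
  have "0 < D (-5) 1 2 3 5"
    using coherentD[OF anti, of "-5" "-2" "-1" "-3" 5] by (simp add: oriented_stable_facets_def sort_args)
  have "0 < D 2 3 4 5 6"
    using coherentD[OF pos, of 6 2 3 4 5] by (simp add: oriented_stable_facets_def sort_args)
  have "D (-5) 2 3 4 5 < 0"
    using coherentD[OF pos, of "-5" 3 2 4 5] by (simp add: oriented_stable_facets_def sort_args)
  have "0 < D 1 2 3 5 6"
    using coherentD[OF anti, of "-5" "-2" "-1" "-3" "-6"] by (simp add: oriented_stable_facets_def sort_args)
  have "D 1 2 3 4 5 < 0"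
    using coherentD[OF anti, of "-5" "-2" "-1" "-3" "-4"] by (simp add: oriented_stable_facets_def sort_args)
  have "D (-6) (-5) (-4) 2 3 < 0"
    using coherentD[OF anti, of 6 "-2" "-3" 4 5] by (simp add: oriented_stable_facets_def sort_args)
  have "D (-6) 2 3 4 5 < 0"
    using coherentD[OF anti, of 6 "-3" "-4" "-5" "-2"] by (simp add: oriented_stable_facets_def sort_args)
  have "D (-6) (-5) 2 3 4 < 0"
    using coherentD[OF pos, of "-5" 3 2 4 "-6"] by (simp add: oriented_stable_facets_def sort_args)
  have "0 < D (-6) (-4) 2 3 5"
    using coherentD[OF anti, of 6 "-2" "-3" 4 "-5"] by (simp add: oriented_stable_facets_def sort_args)
  have "0 < D (-6) (-4) 2 3 4"
    using coherentD[OF anti, of 6 "-2" "-3" 4 "-4"] by (simp add: oriented_stable_facets_def sort_args)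
  have "0 < D (-1) 1 2 3 5"
    using coherentD[OF anti, of "-5" "-2" "-1" "-3" 1] by (simp add: oriented_stable_facets_def sort_args)
  have "0 < D (-6) (-1) 2 3 5"
    using coherentD[OF anti, of 6 1 "-3" "-5" "-2"] by (simp add: oriented_stable_facets_def sort_args)
  have "0 < D (-6) 1 2 3 5"
    using coherentD[OF anti, of "-5" "-2" "-1" "-3" 6] by (simp add: oriented_stable_facets_def sort_args)
  have "0 < D (-5) (-3) (-1) 2 3"
    using coherentD[OF pos, of "-5" "-1" 2 "-3" 3] by (simp add: oriented_stable_facets_def sort_args)
  have "0 < D (-5) (-3) 2 3 4"
    using coherentD[OF pos, of "-5" 3 2 4 "-3"] by (simp add: oriented_stable_facets_def sort_args)
  have "0 < D (-5) (-1) 2 3 4"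
    using coherentD[OF pos, of "-5" 2 "-1" 4 3] by (simp add: oriented_stable_facets_def sort_args)
  have "0 < D (-5) 1 2 3 4"
    using coherentD[OF pos, of "-5" 3 2 4 1] by (simp add: oriented_stable_facets_def sort_args)
  have "0 < D (-5) (-4) 1 2 3"
    using coherentD[OF anti, of "-2" "-1" "-3" 4 5] by (simp add: oriented_stable_facets_def sort_args)
  have "0 < D (-5) (-4) 2 3 4"
    using coherentD[OF pos, of "-5" 3 2 4 "-4"] by (simp add: oriented_stable_facets_def sort_args)
  have "D (-5) (-3) 1 2 3 < 0"
    using coherentD[OF pos, of "-5" 2 1 "-3" 3] by (simp add: oriented_stable_facets_def sort_args)
  have "0 < D (-5) (-4) (-3) 1 2"
    using coherentD[OF pos, of "-5" 2 1 "-3" "-4"] by (simp add: oriented_stable_facets_def sort_args)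
  have "D (-5) (-3) 1 2 6 < 0"
    using coherentD[OF pos, of 6 1 "-3" "-5" 2] by (simp add: oriented_stable_facets_def sort_args)
  have "D (-5) (-4) (-3) 2 6 < 0"
    using coherentD[OF pos, of 6 "-3" "-4" "-5" 2] by (simp add: oriented_stable_facets_def sort_args)
  have "D (-5) 2 3 4 6 < 0"
    using coherentD[OF pos, of "-5" 3 2 4 6] by (simp add: oriented_stable_facets_def sort_args)
  \<comment> \<open>Brackets whose signs are forced by three-term relations.\<close>
  have "0 < D 2 3 5 (-5) 6 * D 2 3 5 1 4"
    by (rule three_term_pos)
      (use \<open>0 < D (-5) 1 2 3 5\<close> \<open>0 < D 2 3 4 5 6\<close> \<open>D (-5) 2 3 4 5 < 0\<close> \<open>0 < D 1 2 3 5 6\<close>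
       in \<open>simp_all only: sort, simp_all add: mult_signs\<close>)
  then have "0 < D (-5) 2 3 5 6"
    using \<open>D 1 2 3 4 5 < 0\<close> by (simp only: sort) (simp add: zero_less_mult_iff mult_less_0_iff)
  have "0 < D (-6) 2 3 (-5) 5 * D (-6) 2 3 4 (-4)"
    by (rule three_term_pos)
      (use \<open>D (-6) (-5) 2 3 4 < 0\<close> \<open>0 < D (-6) (-4) 2 3 5\<close> \<open>D (-6) (-5) (-4) 2 3 < 0\<close> \<open>D (-6) 2 3 4 5 < 0\<close>
       in \<open>simp_all only: sort, simp_all add: mult_signs\<close>)
  then have "D (-6) (-5) 2 3 5 < 0"
    using \<open>0 < D (-6) (-4) 2 3 4\<close> by (simp only: sort) (simp add: zero_less_mult_iff mult_less_0_iff)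
  have "0 < D 2 3 5 (-6) 1 * D 2 3 5 (-5) (-1)"
    by (rule three_term_pos)
      (use \<open>D (-6) (-5) 2 3 5 < 0\<close> \<open>0 < D (-1) 1 2 3 5\<close> \<open>0 < D (-6) (-1) 2 3 5\<close> \<open>0 < D (-5) 1 2 3 5\<close>
       in \<open>simp_all only: sort, simp_all add: mult_signs\<close>)
  then have "0 < D (-5) (-1) 2 3 5"
    using \<open>0 < D (-6) 1 2 3 5\<close> by (simp only: sort) (simp add: zero_less_mult_iff mult_less_0_iff)
  have "0 < D (-5) 2 3 (-3) 5 * D (-5) 2 3 (-1) 4"
    by (rule three_term_pos)
      (use \<open>0 < D (-5) (-3) (-1) 2 3\<close> \<open>D (-5) 2 3 4 5 < 0\<close> \<open>0 < D (-5) (-3) 2 3 4\<close> \<open>0 < D (-5) (-1) 2 3 5\<close>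
       in \<open>simp_all only: sort, simp_all add: mult_signs\<close>)
  then have "0 < D (-5) (-3) 2 3 5"
    using \<open>0 < D (-5) (-1) 2 3 4\<close> by (simp only: sort) (simp add: zero_less_mult_iff mult_less_0_iff)
  have "0 < D (-5) 2 3 (-4) (-3) * D (-5) 2 3 1 4"
    by (rule three_term_pos)
      (use \<open>0 < D (-5) (-4) 1 2 3\<close> \<open>0 < D (-5) (-3) 2 3 4\<close> \<open>0 < D (-5) (-4) 2 3 4\<close> \<open>D (-5) (-3) 1 2 3 < 0\<close>
       in \<open>simp_all only: sort, simp_all add: mult_signs\<close>)
  then have "0 < D (-5) (-4) (-3) 2 3"
    using \<open>0 < D (-5) 1 2 3 4\<close> by (simp only: sort) (simp add: zero_less_mult_iff mult_less_0_iff)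
  have "0 < D (-5) (-3) 2 (-4) 1 * D (-5) (-3) 2 3 6"
    by (rule three_term_pos)
      (use \<open>0 < D (-5) (-4) (-3) 2 3\<close> \<open>D (-5) (-3) 1 2 6 < 0\<close> \<open>D (-5) (-4) (-3) 2 6 < 0\<close> \<open>D (-5) (-3) 1 2 3 < 0\<close>
       in \<open>simp_all only: sort, simp_all add: mult_signs\<close>)
  then have "D (-5) (-3) 2 3 6 < 0"
    using \<open>0 < D (-5) (-4) (-3) 1 2\<close> by (simp only: sort) (simp add: zero_less_mult_iff mult_less_0_iff)
  have "0 < D (-5) 2 3 (-3) 5 * D (-5) 2 3 4 6"
    by (rule three_term_pos)
      (use \<open>0 < D (-5) (-3) 2 3 4\<close> \<open>0 < D (-5) 2 3 5 6\<close> \<open>D (-5) (-3) 2 3 6 < 0\<close> \<open>D (-5) 2 3 4 5 < 0\<close>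
       in \<open>simp_all only: sort, simp_all add: mult_signs\<close>)
  then show False
    using \<open>0 < D (-5) (-3) 2 3 5\<close> \<open>D (-5) 2 3 4 6 < 0\<close> by (simp only: sort) (simp add: zero_less_mult_iff mult_less_0_iff)
qed

end

context facet_chirotope
begin

lemma not_coherent:
  assumes "stable_facets \<subseteq> \<F>" "\<And>F. F \<in> \<F> \<Longrightarrow> uminus ` F \<in> \<F>"
  shows "\<not> coherent D"
proof -
  interpret anti: facet_chirotope "\<lambda>a b c d e. D (- a) (- b) (- c) (- d) (- e)" \<F>
    using assms(2) by (rule facet_chirotope_antipodal)
  show ?thesis
    using anti.coherent_or_opposite[OF assms(1)] not_coherent_same not_coherent_opposite by blast
qed

lemma antipodal_facets_impossible:
  assumes "stable_facets \<subseteq> \<F>" "\<And>F. F \<in> \<F> \<Longrightarrow> uminus ` F \<in> \<F>"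
  shows False
proof -
  interpret neg: facet_chirotope "\<lambda>a b c d e. - D a b c d e" \<F> by (rule facet_chirotope_uminus)
  show ?thesis
    using coherent_or_opposite[OF assms(1)] not_coherent[OF assms] neg.not_coherent[OF assms] by blast
qed

end

section \<open>Nonpolytopality\<close>

lemma core_vertices_eq: "core_vertices = {1, 2, 3, 4, 5, 6, -1, -2, -3, -4, -5, -6}"
  by auto presburger

lemma core_vertices_subset:
  assumes "stable_facets \<subseteq> \<F>" "\<And>F. F \<in> \<F> \<Longrightarrow> uminus ` F \<in> \<F>"
  shows "core_vertices \<subseteq> \<Union>\<F>"
proof -
  have opp: "- x \<in> \<Union>\<F>" if x: "x \<in> \<Union>\<F>" for x
  proof -
    obtain F where "F \<in> \<F>" "x \<in> F" using x by (rule UnionE)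
    then show ?thesis using assms(2)[of F] by (intro UnionI[of "uminus ` F"]) simp_all
  qed
  have "{1, 2, -3, 4, -5, 6} \<subseteq> \<Union>stable_facets"
    by (simp add: stable_facets_def oriented_stable_facets_def)
  then have "{1, 2, -3, 4, -5, 6} \<subseteq> \<Union>\<F>"
    using Union_mono[OF assms(1)] by (rule subset_trans)
  then show ?thesis
    using opp[of 1] opp[of 2] opp[of "-3"] opp[of 4] opp[of "-5"] opp[of 6]
    unfolding core_vertices_eq by (simp only: insert_subset) simp
qed

theorem theorem17:
  fixes n :: nat
  assumes "n \<ge> 6"
  shows "\<not> polytopal TYPE('a::euclidean_space) (Delta3 n)"
proof
  let ?F = "Delta3_facets n"
  assume "polytopal TYPE('a) (Delta3 n)"
  then have real: "polytopal TYPE('a) (complex_of_facets ?F)" by (simp add: Delta3_def)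
  have stable: "stable_facets \<subseteq> ?F" using assms by (rule stable_facets_subset)
  have antipodal: "uminus ` F \<in> ?F" if "F \<in> ?F" for F
    by (rule uminus_mem_Delta3[OF _ that]) (use assms in simp)
  have card: "\<forall>F \<in> ?F. card F = 4"
    by (intro ballI card_Delta3[of n]) (use assms in simp)
  have F0: "{-1, 2, -3, 4} \<in> ?F"
    using stable by (simp add: stable_facets_def oriented_stable_facets_def)
  have core: "core_vertices \<subseteq> \<Union>?F" using stable antipodal by (rule core_vertices_subset)
  note core_Diff = Diff_mono[OF core order_refl, THEN subsetD]
  have v0: "1 \<in> \<Union>?F - {-1, 2, -3, 4}" by (rule core_Diff) simp
  obtain u :: "int \<Rightarrow> real^Enum.finite_5" where
    u: "\<forall>a b c d x y. {a, b, c, d} \<in> ?F \<longrightarrow>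
          x \<in> \<Union>?F - {a, b, c, d} \<longrightarrow> y \<in> \<Union>?F - {a, b, c, d} \<longrightarrow>
          0 < bracket (u a) (u b) (u c) (u d) (u x) * bracket (u a) (u b) (u c) (u d) (u y)"
    using polytopal_brackets[OF real card F0 v0] by (elim exE)
  interpret facet_chirotope "\<lambda>a b c d e. bracket (u a) (u b) (u c) (u d) (u e)" ?F
  proof unfold_locales
    fix a b c d x y
    assume F: "{a, b, c, d} \<in> ?F"
      and x: "x \<in> core_vertices - {a, b, c, d}" and y: "y \<in> core_vertices - {a, b, c, d}"
    show "0 < bracket (u a) (u b) (u c) (u d) (u x) * bracket (u a) (u b) (u c) (u d) (u y)"
      by (rule u[rule_format, OF F core_Diff[OF x] core_Diff[OF y]])
  qed (rule bracket_swap three_term_relation)+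
  show False using stable antipodal by (rule antipodal_facets_impossible)
qed

end
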